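(* Let $k,n,p$ be integers, $n\ge 1$, $k\ge 0$, $p\ge 0$, let $\alpha(x,\xi)=\varepsilon+\mathrm{i}\kappa$ with constants $\varepsilon\ge 0$ and $\kappa\in\mathbb{R}$, and let $\mathcal{E}_{(k+n)(p+n)}$ be the field of angular $(p+n)$-moments of the attenuated ray transform $u_{k+n}$ of order $k+n$ of a function $f(x,\xi)$. Then $$\delta^n\mathcal{E}_{(k+n)(p+n)}=\sum_{j=0}^n(-1)^j\binom{n}{j}\alpha^j\,\frac{(k+n)!}{(k+j)!}\,\mathcal{E}_{(k+j)p},$$ where $\binom{n}{j}=\frac{n!}{j!(n-j)!}$.
   Context: $D\subset\mathbb{R}^3$ is a bounded convex domain with smooth boundary, $\mathbb{S}^2$ is the unit sphere of $\mathbb{R}^3$, and $\mathbb{S}D=\{(x,\xi): x\in D,\ \xi\in\mathbb{S}^2\}$. The function $f\in C^1(\mathbb{S}D)$ is bounded and finite with respect to $x$, i.e. it vanishes for $x$ outside some compact subset of $D$; it is extended by zero to all $x\in\mathbb{R}^3$. For constant $\alpha$, the attenuated ray transform (ART) of order $k\ge0$ of $f$ is $$u_k(x,\xi)=\int_0^\infty s^k e^{-\alpha s} f(x-s\xi,\xi)\,ds .$$ The integral angular $p$-moment of the ART of order $k$ is the symmetric $p$-tensor field $\mathcal{E}_{kp}$ with components $$\mathcal{E}_{kp}^{i_1\ldots i_p}(x)=\int_{\mathbb{S}^2}u_k(x,\xi)\,\xi^{i_1}\cdots\xi^{i_p}\,d\lambda(\xi),\qquad p\ge 0,$$ (a scalar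 field for $p=0$), where $\xi^i$ are the components of the unit vector $\xi$ and $d\lambda$ is the angular (surface) measure on the unit sphere. The divergence $\delta$ maps symmetric tensor fields of rank $m+1$ to symmetric tensor fields of rank $m$: $(\delta w)_{j_1\ldots j_m}=\sum_{q=1}^3\frac{\partial w_{j_1\ldots j_m q}}{\partial x^q}$; $\delta^n$ is its $n$-fold iteration. (Upper and lower indices are not distinguished in Cartesian coordinates.) *)

theory Defs
  imports "HOL-Analysis.Analysis"
begin

text \<open>\<^term>\<open>Ck_on_open k f U\<close> is the class $C^k(U)$ and is meant for open \<^term>\<open>U\<close> only.\<close>

fun Ck_on_open :: "nat \<Rightarrow> ('a::euclidean_space \<Rightarrow> 'b::real_normed_vector) \<Rightarrow> 'a set \<Rightarrow> bool" where
  "Ck_on_open 0 f U \<longleftrightarrow> continuous_on U f"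
| "Ck_on_open (Suc k) f U \<longleftrightarrow>
     (\<forall>x\<in>U. f differentiable (at x)) \<and>
     (\<forall>b\<in>Basis. Ck_on_open k (\<lambda>x. frechet_derivative f (at x) b) U)"

text \<open>On an arbitrary set, such as the submanifold $D \times S^2$ of $R^3 \times R^3$,
  a function is $C^k$ if near each point of the set it is the restriction of a $C^k$ function
  defined on an open subset of the ambient space.\<close>

definition Ck_on :: "nat \<Rightarrow> ('a::euclidean_space \<Rightarrow> 'b::real_normed_vector) \<Rightarrow> 'a set \<Rightarrow> bool" where
  "Ck_on k f S \<longleftrightarrow>
     (\<forall>z\<in>S. \<exists>W g. open W \<and> z \<in> W \<and> Ck_on_open k g W \<and> (\<forall>y\<in>W \<inter> S. g y = f y))"

definition smooth_boundary :: "'a::euclidean_space set \<Rightarrow> bool" where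
  "smooth_boundary D \<longleftrightarrow>
     (\<forall>z\<in>frontier D. \<exists>W \<rho>::'a \<Rightarrow> real. open W \<and> z \<in> W \<and> (\<forall>k. Ck_on_open k \<rho> W) \<and>
        (\<forall>y\<in>W. frechet_derivative \<rho> (at y) \<noteq> (\<lambda>_. 0)) \<and>
        D \<inter> W = {y \<in> W. \<rho> y < 0})"

abbreviation unit_sphere :: "(real^3) set" where
  "unit_sphere \<equiv> sphere 0 1"

definition spherical_coords :: "real \<times> real \<Rightarrow> real^3" where
  "spherical_coords = (\<lambda>(\<theta>, \<phi>). vector [sin \<theta> * cos \<phi>, sin \<theta> * sin \<phi>, cos \<theta>])"

text \<open>The surface measure on the unit sphere. The density $\sin\theta$ is the norm of the cross
  product of the two partial derivatives of the parametrisation, which is injective up to a null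
  set. The space of this measure is the sphere itself, so the values of an integrand
  off the sphere play no role.\<close>

definition sphere_measure :: "(real^3) measure" where
  "sphere_measure =
     distr (density lborel (\<lambda>(\<theta>, \<phi>). ennreal (indicator ({0..pi} \<times> {0..2*pi}) (\<theta>, \<phi>) * sin \<theta>)))
       (restrict_space borel unit_sphere) spherical_coords"

definition ray_transform ::
    "complex \<Rightarrow> (real^3 \<Rightarrow> real^3 \<Rightarrow> complex) \<Rightarrow> nat \<Rightarrow> real^3 \<Rightarrow> real^3 \<Rightarrow> complex" where
  "ray_transform \<alpha> f k x \<xi> =
     (LINT s:{0..}|lborel. of_real (s ^ k) * exp (- \<alpha> * of_real s) * f (x - s *\<^sub>R \<xi>) \<xi>)"

text \<open>A tensor field of rank $p$ is given by its Cartesian components, indexed by the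
  multi-indices $[i_1, \ldots, i_p]$; entries at lists of any other length are irrelevant.\<close>

type_synonym tensor_field = "real^3 \<Rightarrow> 3 list \<Rightarrow> complex"

definition angular_moment ::
    "complex \<Rightarrow> (real^3 \<Rightarrow> real^3 \<Rightarrow> complex) \<Rightarrow> nat \<Rightarrow> nat \<Rightarrow> tensor_field" where
  "angular_moment \<alpha> f k p x idx =
     (if length idx = p
      then (\<integral>\<xi>. ray_transform \<alpha> f k x \<xi> * of_real (\<Prod>i\<leftarrow>idx. \<xi> $ i) \<partial>sphere_measure)
      else 0)"

definition has_partial :: "3 \<Rightarrow> (real^3 \<Rightarrow> complex) \<Rightarrow> real^3 \<Rightarrow> bool" where
  "has_partial q g x \<longleftrightarrow> (\<lambda>t::real. g (x + t *\<^sub>R axis q 1)) differentiable (at 0)"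

definition partial :: "3 \<Rightarrow> (real^3 \<Rightarrow> complex) \<Rightarrow> real^3 \<Rightarrow> complex" where
  "partial q g x = vector_derivative (\<lambda>t::real. g (x + t *\<^sub>R axis q 1)) (at 0)"

definition divergence :: "tensor_field \<Rightarrow> tensor_field" where
  "divergence w x js = (\<Sum>q\<in>UNIV. partial q (\<lambda>y. w y (js @ [q])) x)"

text \<open>Existence of all the partial derivatives entering the divergence of a field of rank $m+1$;
  needed because \<^const>\<open>vector_derivative\<close> is total.\<close>

definition divergence_exists :: "nat \<Rightarrow> tensor_field \<Rightarrow> bool" where
  "divergence_exists m w \<longleftrightarrow>
     (\<forall>x js q. length js = m \<longrightarrow> has_partial q (\<lambda>y. w y (js @ [q])) x)"

end

theory Submission
  imports Defs
begin

text \<open>The reason for the identity is that \<open>u\<^sub>k\<close> solves a transport equation. The integrand of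
the ray transform depends on \<open>x\<close> and \<open>s\<close> through \<open>x - s \<xi>\<close>, so that differentiating it in \<open>x\<close>
along \<open>\<xi>\<close> is differentiating it in \<open>s\<close> up to sign. An integration by parts moves that derivative
to the weight \<open>s\<^sup>k\<^sup>+\<^sup>1 exp (- \<alpha> s)\<close>; the boundary terms vanish, at \<open>0\<close> because of the power
of \<open>s\<close> and far away because \<open>f\<close> is finite. This gives
\<open>\<xi> \<bullet> \<nabla>u\<^bsub>k+1\<^esub> = (k + 1) u\<^sub>k - \<alpha> u\<^bsub>k+1\<^esub>\<close> (\<open>transport_equation\<close>).

The divergence of the moments of rank \<open>p + 1\<close> contracts the gradient of \<open>u\<close> with one factor \<open>\<xi>\<close>,
so that integrating the transport equation over the sphere against a monomial of degree \<open>p\<close> gives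
\<open>\<delta> E\<^bsub>(k+1)(p+1)\<^esub> = (k + 1) E\<^bsub>kp\<^esub> - \<alpha> E\<^bsub>(k+1)p\<^esub>\<close> (\<open>divergence_angular_moment\<close>). After division
of every \<open>E\<^bsub>kp\<^esub>\<close> by \<open>k!\<close> this says that \<open>\<delta>\<close> acts as a difference of two neighbours, and its
iterates have binomial coefficients by Pascal's rule (\<open>divergence_funpow_angular_moment\<close>).

The analytic content is the differentiation under both integral signs. Although \<open>s\<close> ranges over
a half-line, finiteness of \<open>f\<close> bounds the effective range of \<open>s\<close> locally uniformly in \<open>x\<close>, and the
sphere is parametrised by a compact rectangle; so each integral is one of a continuous function over
a compact box, and the Leibniz rule applies once the gradient of \<open>f\<close> in \<open>x\<close> is known to be jointly
continuous on all of \<open>R\<^sup>3 \<times> S\<^sup>2\<close> (\<open>position_gradient_exists\<close>).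
In this form the \<open>q\<close>-th partial derivative of a moment of \<open>f\<close> is the corresponding moment of
\<open>\<partial>f/\<partial>x\<^sup>q\<close>, an integrand of the same kind.\<close>

section \<open>The ray transform of a continuous finite integrand\<close>

lemma continuous_on_locally:
  fixes f :: "'a::t2_space \<Rightarrow> 'b::topological_space"
  assumes "\<And>z. z \<in> S \<Longrightarrow> \<exists>V. open V \<and> z \<in> V \<and> continuous_on (S \<inter> V) f"
  shows "continuous_on S f"
  unfolding continuous_on_eq_continuous_within
proof
  fix z assume z: "z \<in> S"
  then obtain V where V: "open V" "z \<in> V" "continuous_on (S \<inter> V) f"
    using assms by blast
  have "at z within S \<inter> V = at z within S"
    using V by (intro at_within_nhd[of z V]) auto
  then show "continuous (at z within S) f"
    using V z by (metis IntI continuous_on_eq_continuous_within)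
qed

text \<open>The ray transform of such an \<open>f\<close> is a proper integral. No differentiability is built in, so
that the partial derivatives in \<open>x\<close> of a \<open>C\<^sup>1\<close> integrand belong to the same class and the lemmas on
it serve for both. Directions off the sphere are left unconstrained, as \<open>f\<close> is arbitrary there.\<close>

definition source :: "real \<Rightarrow> (real^3 \<Rightarrow> real^3 \<Rightarrow> complex) \<Rightarrow> bool" where
  "source r f \<longleftrightarrow> continuous_on (UNIV \<times> unit_sphere) (\<lambda>(x, \<xi>). f x \<xi>) \<and>
     (\<forall>x \<xi>. \<xi> \<in> unit_sphere \<longrightarrow> r \<le> norm x \<longrightarrow> f x \<xi> = 0)"

lemma source_cont:
  assumes "source r f" "continuous_on A a" "continuous_on A b" "b ` A \<subseteq> unit_sphere"
  shows "continuous_on A (\<lambda>z. f (a z) (b z))"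
proof -
  have "continuous_on A (\<lambda>z. (\<lambda>(x, \<xi>). f x \<xi>) (a z, b z))"
    by (rule continuous_on_compose2[of "UNIV \<times> unit_sphere"])
       (use assms in \<open>auto simp: source_def intro: continuous_on_Pair\<close>)
  then show ?thesis by simp
qed

text \<open>By the triangle inequality the point \<open>x - s \<xi>\<close> has left the open ball of radius \<open>r\<close> as soon as
\<open>s\<close> reaches \<open>norm x + r\<close>; this bound is uniform in \<open>\<xi>\<close> and locally uniform in \<open>x\<close>.\<close>

lemma source_vanishes:
  assumes "source r f" "\<xi> \<in> unit_sphere" "norm x + r \<le> s"
  shows "f (x - s *\<^sub>R \<xi>) \<xi> = 0"
proof -
  have "norm (s *\<^sub>R \<xi>) \<le> norm (x - s *\<^sub>R \<xi>) + norm x"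
    by (metis norm_minus_commute norm_triangle_sub add.commute)
  then show ?thesis
    using assms unfolding source_def by simp
qed

abbreviation ray_integrand where
  "ray_integrand \<alpha> f k x \<xi> s \<equiv> of_real (s ^ k) * exp (- \<alpha> * of_real s) * f (x - s *\<^sub>R \<xi>) \<xi>"

text \<open>Having the same interval for all \<open>x\<close> in a ball is what makes theorems on parameter-dependent
integrals over compact intervals applicable.\<close>

lemma ray_transform_truncate:
  assumes f: "source r f" and \<xi>: "\<xi> \<in> unit_sphere" and R: "norm x + r \<le> R"
  shows "ray_transform \<alpha> f k x \<xi> = integral {0..R} (ray_integrand \<alpha> f k x \<xi>)"
proof -
  have "ray_transform \<alpha> f k x \<xi> = (LINT s:{0..R}|lborel. ray_integrand \<alpha> f k x \<xi> s)"
    unfolding ray_transform_def set_lebesgue_integral_def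
    by (rule Bochner_Integration.integral_cong)
       (use source_vanishes[OF f \<xi>] R in \<open>auto simp: indicator_def\<close>)
  also have "\<dots> = integral {0..R} (ray_integrand \<alpha> f k x \<xi>)"
    by (intro set_borel_integral_eq_integral borel_integrable_atLeastAtMost'
          continuous_intros source_cont[OF f]) (use \<xi> in auto)
  finally show ?thesis .
qed

lemma ray_transform_continuous:
  assumes f: "source r f"
  shows "continuous_on (UNIV \<times> unit_sphere) (\<lambda>(x, \<xi>). ray_transform \<alpha> f k x \<xi>)"
proof (rule continuous_on_locally)
  fix z :: "(real^3) \<times> (real^3)"
  define M where "M = norm (fst z) + 1"
  let ?S = "(UNIV \<times> unit_sphere) \<inter> (ball 0 M \<times> UNIV) :: ((real^3) \<times> (real^3)) set"
  have "continuous_on ?S (\<lambda>z. integral (cbox 0 (M + r)) (ray_integrand \<alpha> f k (fst z) (snd z)))"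
    by (rule integral_continuous_on_param)
       (auto simp: split_beta intro!: continuous_intros source_cont[OF f])
  then have "continuous_on ?S (\<lambda>(x, \<xi>). ray_transform \<alpha> f k x \<xi>)"
  proof (rule continuous_on_eq)
    show "integral (cbox 0 (M + r)) (ray_integrand \<alpha> f k (fst z) (snd z)) =
      (\<lambda>(x, \<xi>). ray_transform \<alpha> f k x \<xi>) z" if "z \<in> ?S" for z
    using that by (auto simp: ray_transform_truncate[OF f, of _ _ "M + r"])
  qed
  then show "\<exists>V. open V \<and> z \<in> V \<and>
      continuous_on (UNIV \<times> unit_sphere \<inter> V) (\<lambda>(x, \<xi>). ray_transform \<alpha> f k x \<xi>)"
    by (intro exI[of _ "ball 0 M \<times> UNIV"]) (auto simp: M_def mem_Times_iff intro!: open_Times)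
qed

lemma ray_transform_continuous_compose:
  assumes "source r f" "continuous_on A a" "continuous_on A b" "b ` A \<subseteq> unit_sphere"
  shows "continuous_on A (\<lambda>z. ray_transform \<alpha> f k (a z) (b z))"
proof -
  have "continuous_on A (\<lambda>z. (\<lambda>(x, \<xi>). ray_transform \<alpha> f k x \<xi>) (a z, b z))"
    by (rule continuous_on_compose2[OF ray_transform_continuous[OF assms(1)]])
       (use assms in \<open>auto intro: continuous_on_Pair\<close>)
  then show ?thesis by simp
qed

text \<open>Leibniz rule along a line: translating \<open>x\<close> by \<open>t e\<close> translates the argument of \<open>f\<close> by \<open>t e\<close>, so
that the derivative of the transform is the transform of the derivative.\<close>

lemma ray_transform_derivative:
  assumes f: "source r f" and g: "source r g" and \<xi>: "\<xi> \<in> unit_sphere"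
    and deriv: "\<And>x t. ((\<lambda>t. f (x + t *\<^sub>R e) \<xi>) has_vector_derivative g (x + t *\<^sub>R e) \<xi>) (at t)"
  shows "((\<lambda>t. ray_transform \<alpha> f k (x + t *\<^sub>R e) \<xi>) has_vector_derivative
           ray_transform \<alpha> g k (x + t *\<^sub>R e) \<xi>) (at t)"
proof -
  define U where "U = {t - 1<..<t + 1}"
  \<comment> \<open>One radius that works for all base points with parameter in the unit neighbourhood \<open>U\<close> of \<open>t\<close>.\<close>
  define R where "R = norm x + (\<bar>t\<bar> + 1) * norm e + r"
  have U: "open U" "t \<in> U" "convex U" by (auto simp: U_def)
  have trunc: "ray_transform \<alpha> h k (x + \<tau> *\<^sub>R e) \<xi> =
      integral (cbox 0 R) (ray_integrand \<alpha> h k (x + \<tau> *\<^sub>R e) \<xi>)"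
    if "source r h" "\<tau> \<in> U" for h \<tau>
  proof -
    have "norm (x + \<tau> *\<^sub>R e) \<le> norm x + \<bar>\<tau>\<bar> * norm e"
      by (metis norm_scaleR norm_triangle_ineq)
    also have "\<dots> \<le> norm x + (\<bar>t\<bar> + 1) * norm e"
      using that(2) by (intro add_left_mono mult_right_mono) (auto simp: U_def)
    finally show ?thesis
      using ray_transform_truncate[OF that(1) \<xi>, of _ R] by (simp add: R_def)
  qed
  have "((\<lambda>\<tau>. integral (cbox 0 R) (ray_integrand \<alpha> f k (x + \<tau> *\<^sub>R e) \<xi>)) has_vector_derivative
       integral (cbox 0 R) (ray_integrand \<alpha> g k (x + t *\<^sub>R e) \<xi>)) (at t within U)"
  proof (rule leibniz_rule_vector_derivative)
    fix \<tau> s :: real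
    have eq: "(x + \<tau> *\<^sub>R e) - s *\<^sub>R \<xi> = (x - s *\<^sub>R \<xi>) + \<tau> *\<^sub>R e" for \<tau>
      by simp
    show "((\<lambda>\<tau>. ray_integrand \<alpha> f k (x + \<tau> *\<^sub>R e) \<xi> s) has_vector_derivative
        ray_integrand \<alpha> g k (x + \<tau> *\<^sub>R e) \<xi> s) (at \<tau> within U)"
      unfolding eq
      by (rule has_vector_derivative_mult_right[OF has_vector_derivative_at_within[OF deriv]])
  next
    show "ray_integrand \<alpha> f k (x + \<tau> *\<^sub>R e) \<xi> integrable_on cbox 0 R" for \<tau>
      by (intro integrable_continuous continuous_intros source_cont[OF f]) (use \<xi> in auto)
  next
    show "continuous_on (U \<times> cbox 0 R) (\<lambda>(\<tau>, s). ray_integrand \<alpha> g k (x + \<tau> *\<^sub>R e) \<xi> s)"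
      unfolding split_beta by (intro continuous_intros source_cont[OF g]) (use \<xi> in auto)
  qed (use U in auto)
  then have "((\<lambda>\<tau>. integral (cbox 0 R) (ray_integrand \<alpha> f k (x + \<tau> *\<^sub>R e) \<xi>)) has_vector_derivative
       ray_transform \<alpha> g k (x + t *\<^sub>R e) \<xi>) (at t)"
    by (simp only: trunc[OF g U(2)] at_within_open[OF U(2,1)])
  then show ?thesis
    by (rule has_vector_derivative_transform_within_open[OF _ U(1,2)]) (rule trunc[OF f, symmetric])
qed

text \<open>The fundamental theorem of calculus for \<open>s \<mapsto> s\<^sup>k\<^sup>+\<^sup>1 exp (- \<alpha> s) f (x - s \<xi>, \<xi>)\<close> on \<open>[0, R]\<close>. This
function vanishes at both ends, and its derivative is the sum of the three integrands in question.
Raising the order to \<open>k + 1\<close> is what removes the boundary term at \<open>0\<close>, which would be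
\<open>f (x, \<xi>)\<close> for order zero.\<close>

lemma transport_equation:
  assumes f: "source r f" and f': "\<And>q. source r (f' q)" and \<xi>: "\<xi> \<in> unit_sphere"
    and deriv: "\<And>x. ((\<lambda>y. f y \<xi>) has_derivative (\<lambda>h. \<Sum>q\<in>UNIV. (h $ q) *\<^sub>R f' q x \<xi>)) (at x)"
  shows "(\<Sum>q\<in>UNIV. of_real (\<xi> $ q) * ray_transform \<alpha> (f' q) (Suc k) x \<xi>) =
     of_nat (Suc k) * ray_transform \<alpha> f k x \<xi> - \<alpha> * ray_transform \<alpha> f (Suc k) x \<xi>"
proof -
  define R where "R = max 0 (norm x + r)"
  have R: "0 \<le> R" "norm x + r \<le> R" by (auto simp: R_def)
  have int: "ray_integrand \<alpha> h j x \<xi> integrable_on {0..R}" if "source r h" for h j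
    by (intro integrable_continuous_interval continuous_intros source_cont[OF that]) (use \<xi> in auto)
  have along: "((\<lambda>s. f (x - s *\<^sub>R \<xi>) \<xi>) has_vector_derivative
      - (\<Sum>q\<in>UNIV. (\<xi> $ q) *\<^sub>R f' q (x - s *\<^sub>R \<xi>) \<xi>)) (at s within {0..R})" for s
  proof -
    have "((\<lambda>s. x - s *\<^sub>R \<xi>) has_derivative (\<lambda>h. - h *\<^sub>R \<xi>)) (at s within {0..R})"
      by (auto intro!: derivative_eq_intros)
    from has_derivative_compose[OF this deriv] show ?thesis
      by (simp add: has_vector_derivative_def sum_negf scaleR_sum_right)
  qed
  let ?I = "\<lambda>h j s. ray_integrand \<alpha> h j x \<xi> s"
  have total: "((\<lambda>s. of_nat (Suc k) * ?I f k s - \<alpha> * ?I f (Suc k) s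
       - (\<Sum>q\<in>UNIV. of_real (\<xi> $ q) * ?I (f' q) (Suc k) s)) has_integral
       (?I f (Suc k) R - ?I f (Suc k) 0)) {0..R}"
  proof (rule fundamental_theorem_of_calculus[OF R(1)])
    fix s
    have p: "((\<lambda>s. of_real (s ^ Suc k) * exp (- \<alpha> * of_real s)) has_vector_derivative
       of_nat (Suc k) * (of_real (s ^ k) * exp (- \<alpha> * of_real s)) -
       \<alpha> * (of_real (s ^ Suc k) * exp (- \<alpha> * of_real s))) (at s within {0..R})"
    proof -
      have "((\<lambda>z. z ^ Suc k * exp (- \<alpha> * z)) has_field_derivative
         of_nat (Suc k) * (of_real s ^ k * exp (- \<alpha> * of_real s)) -
         \<alpha> * (of_real s ^ Suc k * exp (- \<alpha> * of_real s))) (at (of_real s))"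
        by (rule derivative_eq_intros DERIV_power_Suc refl)+ (simp add: algebra_simps)
      from has_vector_derivative_real_field[OF this, of "{0..R}"] show ?thesis
        by simp
    qed
    from has_vector_derivative_mult[OF p along[of s]]
    show "(?I f (Suc k) has_vector_derivative
        of_nat (Suc k) * ?I f k s - \<alpha> * ?I f (Suc k) s
       - (\<Sum>q\<in>UNIV. of_real (\<xi> $ q) * ?I (f' q) (Suc k) s)) (at s within {0..R})"
      by (rule has_vector_derivative_eq_rhs)
         (simp add: algebra_simps sum_distrib_left scaleR_conv_of_real)
  qed
  have boundary: "?I f (Suc k) R - ?I f (Suc k) 0 = 0"
    using source_vanishes[OF f \<xi> R(2)] by simp
  have "((\<lambda>s. of_nat (Suc k) * ?I f k s - \<alpha> * ?I f (Suc k) s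
       - (\<Sum>q\<in>UNIV. of_real (\<xi> $ q) * ?I (f' q) (Suc k) s)) has_integral
       (of_nat (Suc k) * ray_transform \<alpha> f k x \<xi> - \<alpha> * ray_transform \<alpha> f (Suc k) x \<xi>
         - (\<Sum>q\<in>UNIV. of_real (\<xi> $ q) * ray_transform \<alpha> (f' q) (Suc k) x \<xi>))) {0..R}"
    unfolding ray_transform_truncate[OF f \<xi> R(2)] ray_transform_truncate[OF f' \<xi> R(2)]
    by (intro has_integral_diff has_integral_sum has_integral_mult_right
          integrable_integral int f f') auto
  from has_integral_unique[OF this total[unfolded boundary]] show ?thesis
    by simp
qed

section \<open>Integration over the unit sphere\<close>

lemma spherical_coords_in_sphere: "spherical_coords u \<in> unit_sphere"
proof -
  obtain \<theta> \<phi> where u: "u = (\<theta>, \<phi>)" by (cases u)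
  have "spherical_coords u \<bullet> spherical_coords u =
      (sin \<theta> * cos \<phi>) * (sin \<theta> * cos \<phi>) + (sin \<theta> * sin \<phi>) * (sin \<theta> * sin \<phi>) + cos \<theta> * cos \<theta>"
    unfolding u spherical_coords_def inner_vec_def by (simp add: sum_3)
  also have "\<dots> = (sin \<theta>)\<^sup>2 * ((sin \<phi>)\<^sup>2 + (cos \<phi>)\<^sup>2) + (cos \<theta>)\<^sup>2"
    by algebra
  finally have "spherical_coords u \<bullet> spherical_coords u = 1"
    by simp
  then show ?thesis by (simp add: norm_eq_1)
qed

lemma continuous_on_spherical_coords: "continuous_on A spherical_coords"
proof -
  have "spherical_coords = (\<lambda>u. \<chi> i. if i = 1 then sin (fst u) * cos (snd u)
      else if i = 2 then sin (fst u) * sin (snd u) else cos (fst u))"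
    by (auto simp: fun_eq_iff spherical_coords_def vec_eq_iff forall_3)
  moreover have "continuous_on A \<dots>"
  proof (rule continuous_on_vec_lambda)
    fix i :: 3
    show "continuous_on A (\<lambda>u. if i = 1 then sin (fst u) * cos (snd u)
      else if i = 2 then sin (fst u) * sin (snd u) else cos (fst u))"
      by (cases "i = 1"; cases "i = 2") (auto intro!: continuous_intros)
  qed
  ultimately show ?thesis by (simp only:)
qed

text \<open>Pulling the sphere measure back to the parameter rectangle. Continuity on the sphere alone gives
measurability because the target of the parametrisation carries the Borel structure of the sphere;
compactness of the rectangle then identifies the Lebesgue integral with a Henstock--Kurzweil
integral, for which the Leibniz rule is available.\<close>

lemma
  fixes h :: "real^3 \<Rightarrow> complex"
  assumes h: "continuous_on unit_sphere h"
  shows integrable_sphere_measure: "integrable sphere_measure h"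
    and sphere_integral_eq_box: "(\<integral>\<xi>. h \<xi> \<partial>sphere_measure) =
      integral (cbox (0, 0) (pi, 2 * pi)) (\<lambda>u. sin (fst u) *\<^sub>R h (spherical_coords u))"
proof -
  let ?B = "cbox (0, 0) (pi, 2 * pi) :: (real \<times> real) set"
  define w :: "real \<times> real \<Rightarrow> real" where "w u = indicator ?B u * sin (fst u)" for u
  have w_meas: "w \<in> borel_measurable lborel"
    unfolding w_def
    by (intro borel_measurable_times borel_measurable_indicator)
       (auto intro!: borel_measurable_continuous_onI continuous_intros)
  have w_nonneg: "AE u in lborel. 0 \<le> w u"
    by (auto simp: w_def indicator_def mem_Times_iff sin_ge_zero cbox_Pair_eq)
  have [measurable]: "spherical_coords \<in> borel \<rightarrow>\<^sub>M restrict_space borel unit_sphere"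
    by (intro measurable_restrict_space2 borel_measurable_continuous_onI
        continuous_on_spherical_coords) (use spherical_coords_in_sphere in auto)
  have [measurable]: "h \<in> borel_measurable (restrict_space borel unit_sphere)"
    by (rule borel_measurable_continuous_on_restrict[OF h])
  have "h \<circ> spherical_coords \<in> borel_measurable borel"
    by (rule measurable_comp) measurable
  then have hs: "(\<lambda>u. h (spherical_coords u)) \<in> borel_measurable lborel"
    by (simp add: comp_def)
  have sphere: "sphere_measure =
      distr (density lborel w) (restrict_space borel unit_sphere) spherical_coords"
    unfolding sphere_measure_def w_def
    by (simp add: split_beta' cbox_Pair_eq)
  have coords: "spherical_coords \<in> density lborel w \<rightarrow>\<^sub>M restrict_space borel unit_sphere"
    by simp
  have wh: "w u *\<^sub>R h (spherical_coords u) =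
      indicator ?B u *\<^sub>R (sin (fst u) *\<^sub>R h (spherical_coords u))" for u
    by (simp add: w_def)
  have "set_integrable lborel ?B (\<lambda>u. sin (fst u) *\<^sub>R h (spherical_coords u))"
    unfolding set_integrable_def
    by (intro borel_integrable_compact compact_cbox continuous_intros
        continuous_on_compose2[OF h] continuous_on_spherical_coords)
       (use spherical_coords_in_sphere in auto)
  note box = this set_borel_integral_eq_integral(2)[OF this]
  show "integrable sphere_measure h"
    unfolding sphere using box(1)
    by (simp add: integrable_distr_eq[OF coords] integrable_density[OF hs w_meas w_nonneg]
        wh set_integrable_def)
  show "(\<integral>\<xi>. h \<xi> \<partial>sphere_measure) =
      integral ?B (\<lambda>u. sin (fst u) *\<^sub>R h (spherical_coords u))"
    unfolding sphere box(2)[symmetric]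
    by (simp add: integral_distr[OF coords] integral_density[OF hs w_meas w_nonneg]
        wh set_lebesgue_integral_def)
qed

lemma sphere_integral_derivative:
  fixes v v' :: "real \<Rightarrow> real^3 \<Rightarrow> complex"
  assumes deriv: "\<And>t \<xi>. \<xi> \<in> unit_sphere \<Longrightarrow> ((\<lambda>t. v t \<xi>) has_vector_derivative v' t \<xi>) (at t)"
    and v: "\<And>t. continuous_on unit_sphere (v t)"
    and v': "continuous_on (UNIV \<times> unit_sphere) (\<lambda>(t, \<xi>). v' t \<xi>)"
  shows "((\<lambda>t. \<integral>\<xi>. v t \<xi> \<partial>sphere_measure) has_vector_derivative (\<integral>\<xi>. v' t \<xi> \<partial>sphere_measure)) (at t)"
proof -
  have "continuous_on unit_sphere (\<lambda>\<xi>. (\<lambda>(t, \<xi>). v' t \<xi>) (t, \<xi>))" for t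
    by (rule continuous_on_compose2[OF v']) (auto intro: continuous_on_Pair)
  then have "continuous_on unit_sphere (v' t)" for t
    by simp
  note box = sphere_integral_eq_box[OF v] sphere_integral_eq_box[OF this]
  show ?thesis
    unfolding box
  proof (rule leibniz_rule_vector_derivative)
    show "((\<lambda>t. sin (fst u) *\<^sub>R v t (spherical_coords u)) has_vector_derivative
        sin (fst u) *\<^sub>R v' t (spherical_coords u)) (at t)" for t u
      by (rule has_vector_derivative_scaleR[OF DERIV_const deriv, simplified])
         (use spherical_coords_in_sphere in auto)
    show "(\<lambda>u. sin (fst u) *\<^sub>R v t (spherical_coords u)) integrable_on cbox (0, 0) (pi, 2 * pi)" for t
      by (intro integrable_continuous continuous_intros continuous_on_compose2[OF v]
          continuous_on_spherical_coords) (use spherical_coords_in_sphere in auto)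
    have "continuous_on (UNIV \<times> cbox (0, 0) (pi, 2 * pi))
        (\<lambda>z. (\<lambda>(t, \<xi>). v' t \<xi>) (fst z, spherical_coords (snd z)))"
      by (rule continuous_on_compose2[OF v'])
         (use spherical_coords_in_sphere in \<open>auto intro!: continuous_on_Pair
            continuous_on_fst continuous_on_compose2[OF continuous_on_spherical_coords] continuous_on_snd\<close>)
    then show "continuous_on (UNIV \<times> cbox (0, 0) (pi, 2 * pi))
        (\<lambda>(t, u). sin (fst u) *\<^sub>R v' t (spherical_coords u))"
      unfolding split_beta by (intro continuous_intros) simp
  qed auto
qed

section \<open>The gradient in the position variable\<close>

text \<open>Here \<open>f' q\<close> is \<open>\<partial>f/\<partial>x\<^sup>q\<close>. A single radius \<open>r\<close> serves for the function and its derivatives, and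
membership in \<^const>\<open>source\<close> includes their joint continuity in \<open>(x, \<xi>)\<close>.\<close>

definition position_gradient ::
    "real \<Rightarrow> (real^3 \<Rightarrow> real^3 \<Rightarrow> complex) \<Rightarrow> (3 \<Rightarrow> real^3 \<Rightarrow> real^3 \<Rightarrow> complex) \<Rightarrow> bool" where
  "position_gradient r f f' \<longleftrightarrow> source r f \<and> (\<forall>q. source r (f' q)) \<and>
     (\<forall>\<xi>\<in>unit_sphere. \<forall>x. ((\<lambda>y. f y \<xi>) has_derivative (\<lambda>h. \<Sum>q\<in>UNIV. (h $ q) *\<^sub>R f' q x \<xi>)) (at x))"

lemma linear_eq_sum_axis:
  fixes A :: "real^'n \<Rightarrow> 'b::real_vector"
  assumes "linear A"
  shows "A h = (\<Sum>q\<in>UNIV. (h $ q) *\<^sub>R A (axis q 1))"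
proof -
  have "A h = A (\<Sum>q\<in>UNIV. (h $ q) *\<^sub>R axis q 1)"
    using basis_expansion[of h] by (simp add: scalar_mult_eq_scaleR)
  also have "\<dots> = (\<Sum>q\<in>UNIV. (h $ q) *\<^sub>R A (axis q 1))"
    using assms by (simp add: linear_sum linear_scale)
  finally show ?thesis .
qed

text \<open>Near a point of \<open>D \<times> S\<^sup>2\<close>, \<open>f\<close> is the restriction of some \<open>g\<close> that is \<open>C\<^sup>1\<close> on an open set of the
ambient space. Since \<open>D\<close> is open, \<open>f (\<cdot>, \<eta>)\<close> and \<open>g (\<cdot>, \<eta>)\<close> agree on a whole neighbourhood of \<open>y\<close>,
so the derivative of \<open>f\<close> in \<open>x\<close> is that of \<open>g\<close> in the horizontal directions \<open>(b, 0)\<close>,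
whatever extension was chosen.\<close>

lemma C1_local_gradient:
  fixes f :: "real^3 \<Rightarrow> real^3 \<Rightarrow> complex"
  assumes D: "open D" and f: "Ck_on 1 (\<lambda>(x, \<xi>). f x \<xi>) (D \<times> unit_sphere)"
    and z: "x \<in> D" "\<xi> \<in> unit_sphere"
  obtains V where "open V" "(x, \<xi>) \<in> V" "V \<subseteq> D \<times> UNIV"
    "continuous_on (UNIV \<times> unit_sphere \<inter> V) (\<lambda>(x, \<xi>). f x \<xi>)"
    "\<And>b. b \<in> Basis \<Longrightarrow>
       continuous_on (UNIV \<times> unit_sphere \<inter> V) (\<lambda>(x, \<xi>). frechet_derivative (\<lambda>y. f y \<xi>) (at x) b)"
    "(\<lambda>y. f y \<xi>) differentiable (at x)"
proof -
  obtain W g where W: "open W" "(x, \<xi>) \<in> W" and g: "Ck_on_open 1 g W"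
    and gf: "\<And>y \<eta>. (y, \<eta>) \<in> W \<Longrightarrow> y \<in> D \<Longrightarrow> \<eta> \<in> unit_sphere \<Longrightarrow> g (y, \<eta>) = f y \<eta>"
  proof -
    have "(x, \<xi>) \<in> D \<times> unit_sphere"
      using z by simp
    then obtain W g where "open W" "(x, \<xi>) \<in> W" "Ck_on_open 1 g W"
      and "\<forall>w\<in>W \<inter> D \<times> unit_sphere. g w = (\<lambda>(x, \<xi>). f x \<xi>) w"
      using f unfolding Ck_on_def by blast
    then show ?thesis
      by (intro that[of W g]) auto
  qed
  define V where "V = W \<inter> D \<times> UNIV"
  have V: "open V" "(x, \<xi>) \<in> V" "V \<subseteq> D \<times> UNIV" "V \<subseteq> W"
    using W z D by (auto simp: V_def intro!: open_Int open_Times)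
  have dg: "g differentiable (at w)" if "w \<in> V" for w
    using g V that by (auto simp: One_nat_def)
  have cg: "continuous_on V (\<lambda>w. frechet_derivative g (at w) b)" if "b \<in> Basis" for b
    using g that by (intro continuous_on_subset[OF _ V(4)]) (simp add: One_nat_def)
  have slice: "((\<lambda>y. f y \<eta>) has_derivative (\<lambda>h. frechet_derivative g (at (y, \<eta>)) (h, 0))) (at y)"
    if "(y, \<eta>) \<in> V" "\<eta> \<in> unit_sphere" for y \<eta>
  proof (rule has_derivative_transform_within_open)
    have "((\<lambda>y. (y, \<eta>)) has_derivative (\<lambda>h. (h, 0))) (at y)"
      by (intro has_derivative_Pair has_derivative_ident has_derivative_const)
    from has_derivative_compose[OF this dg[OF that(1), unfolded frechet_derivative_works]]
    show "((\<lambda>y. g (y, \<eta>)) has_derivative (\<lambda>h. frechet_derivative g (at (y, \<eta>)) (h, 0))) (at y)" .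
    show "open ((\<lambda>y. (y, \<eta>)) -` V)"
      by (intro open_vimage V continuous_intros)
  qed (use that gf in \<open>auto simp: V_def\<close>)
  show ?thesis
  proof (rule that[OF V(1-3)])
    have "continuous_on V g"
      using dg by (meson differentiable_at_imp_differentiable_on differentiable_imp_continuous_on)
    then have "continuous_on (UNIV \<times> unit_sphere \<inter> V) g"
      by (rule continuous_on_subset) auto
    then show "continuous_on (UNIV \<times> unit_sphere \<inter> V) (\<lambda>(x, \<xi>). f x \<xi>)"
      by (rule continuous_on_eq) (use gf in \<open>auto simp: V_def\<close>)
    show "(\<lambda>y. f y \<xi>) differentiable (at x)"
      using slice V(2) z(2) unfolding differentiable_def by blast
    show "continuous_on (UNIV \<times> unit_sphere \<inter> V)
        (\<lambda>(x, \<xi>). frechet_derivative (\<lambda>y. f y \<xi>) (at x) b)" if b: "b \<in> Basis" for b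
    proof -
      have "continuous_on V (\<lambda>w. frechet_derivative g (at w) (b, 0))"
        using b by (intro cg) (simp add: Basis_prod_def)
      then have "continuous_on (UNIV \<times> unit_sphere \<inter> V) (\<lambda>w. frechet_derivative g (at w) (b, 0))"
        by (rule continuous_on_subset) auto
      then show ?thesis
        by (rule continuous_on_eq) (auto dest!: slice frechet_derivative_at simp: fun_eq_iff)
    qed
  qed
qed

text \<open>\<open>D\<close> and the complement of the compact set \<open>K\<close> are open and cover the space. On the first the previous
lemma applies, on the second the function and its gradient are zero; since continuity and
differentiability are local, this is enough.\<close>

lemma position_gradient_exists:
  assumes D: "open D" and f: "Ck_on 1 (\<lambda>(x, \<xi>). f x \<xi>) (D \<times> unit_sphere)"
    and K: "compact K" "K \<subseteq> D"
    and vanish: "\<And>x \<xi>. x \<notin> K \<Longrightarrow> \<xi> \<in> unit_sphere \<Longrightarrow> f x \<xi> = 0"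
  shows "\<exists>r f'. position_gradient r f f'"
proof -
  define G where "G = (\<lambda>b x \<xi>. frechet_derivative (\<lambda>y. f y \<xi>) (at x) b)"
  obtain r where r: "\<And>x. x \<in> K \<Longrightarrow> norm x < r"
    using compact_imp_bounded[OF K(1)] bounded_pos_less by blast
  have open_K: "open (- K)"
    using K(1) compact_imp_closed by blast
  have off_K: "((\<lambda>y. f y \<xi>) has_derivative (\<lambda>_. 0)) (at x)" if "x \<notin> K" "\<xi> \<in> unit_sphere" for x \<xi>
    by (rule has_derivative_transform_within_open[OF has_derivative_const open_K])
       (use that vanish in auto)
  have G_off_K: "G b x \<xi> = 0" if "x \<notin> K" "\<xi> \<in> unit_sphere" for b x \<xi>
    using frechet_derivative_at[OF off_K[OF that]] by (simp add: G_def fun_eq_iff)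
  have continuous: "continuous_on (UNIV \<times> unit_sphere) (\<lambda>(x, \<xi>). F x \<xi>)"
    if on_D: "\<And>x \<xi>. x \<in> D \<Longrightarrow> \<xi> \<in> unit_sphere \<Longrightarrow>
        \<exists>V. open V \<and> (x, \<xi>) \<in> V \<and> continuous_on (UNIV \<times> unit_sphere \<inter> V) (\<lambda>(x, \<xi>). F x \<xi>)"
      and zero: "\<And>x \<xi>. x \<notin> K \<Longrightarrow> \<xi> \<in> unit_sphere \<Longrightarrow> F x \<xi> = 0"
    for F :: "real^3 \<Rightarrow> real^3 \<Rightarrow> complex"
  proof (rule continuous_on_locally)
    fix z :: "(real^3) \<times> (real^3)" assume z: "z \<in> UNIV \<times> unit_sphere"
    show "\<exists>V. open V \<and> z \<in> V \<and> continuous_on (UNIV \<times> unit_sphere \<inter> V) (\<lambda>(x, \<xi>). F x \<xi>)"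
    proof (cases "fst z \<in> D")
      case True
      then show ?thesis using on_D[of "fst z" "snd z"] z by auto
    next
      case False
      have "continuous_on (UNIV \<times> unit_sphere \<inter> (- K) \<times> UNIV) (\<lambda>(x, \<xi>). F x \<xi>)"
        by (rule continuous_on_eq[OF continuous_on_const[of _ 0]]) (use zero in auto)
      then show ?thesis
        using False K(2) open_K
        by (intro exI[of _ "(- K) \<times> UNIV"]) (auto simp: mem_Times_iff intro!: open_Times)
    qed
  qed
  have "source r f"
    unfolding source_def
  proof (intro conjI continuous vanish allI impI)
    show "\<exists>V. open V \<and> (x, \<xi>) \<in> V \<and> continuous_on (UNIV \<times> unit_sphere \<inter> V) (\<lambda>(x, \<xi>). f x \<xi>)"
      if "x \<in> D" "\<xi> \<in> unit_sphere" for x \<xi>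
      using C1_local_gradient[OF D f that] by metis
  qed (use r in force)+
  moreover have "source r (G (axis q 1))" for q
    unfolding source_def
  proof (intro conjI continuous G_off_K allI impI)
    show "\<exists>V. open V \<and> (x, \<xi>) \<in> V \<and>
        continuous_on (UNIV \<times> unit_sphere \<inter> V) (\<lambda>(x, \<xi>). G (axis q 1) x \<xi>)"
      if "x \<in> D" "\<xi> \<in> unit_sphere" for x \<xi>
      unfolding G_def by (rule C1_local_gradient[OF D f that]) (use axis_in_Basis_iff in fastforce)
  qed (use r in force)+
  moreover have "((\<lambda>y. f y \<xi>) has_derivative (\<lambda>h. \<Sum>q\<in>UNIV. (h $ q) *\<^sub>R G (axis q 1) x \<xi>)) (at x)"
    if \<xi>: "\<xi> \<in> unit_sphere" for x \<xi>
  proof -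
    have "(\<lambda>y. f y \<xi>) differentiable (at x)"
    proof (cases "x \<in> D")
      case True
      from C1_local_gradient[OF D f this \<xi>] show ?thesis .
    next
      case False
      then show ?thesis
        using off_K[OF _ \<xi>, of x] K(2) unfolding differentiable_def by blast
    qed
    then have "((\<lambda>y. f y \<xi>) has_derivative frechet_derivative (\<lambda>y. f y \<xi>) (at x)) (at x)"
      by (simp add: frechet_derivative_works)
    moreover from this have "linear (frechet_derivative (\<lambda>y. f y \<xi>) (at x))"
      by (rule has_derivative_linear)
    ultimately show ?thesis
      unfolding G_def by (simp add: linear_eq_sum_axis[symmetric])
  qed
  ultimately show ?thesis
    unfolding position_gradient_def
    by (intro exI[of _ r] exI[of _ "\<lambda>q. G (axis q 1)"]) auto
qed

section \<open>Angular moments and their divergence\<close>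

lemma position_gradient_along_axis:
  assumes "position_gradient r f f'" "\<xi> \<in> unit_sphere"
  shows "((\<lambda>t. f (x + t *\<^sub>R axis q 1) \<xi>) has_vector_derivative f' q (x + t *\<^sub>R axis q 1) \<xi>) (at t)"
proof -
  have "((\<lambda>t. x + t *\<^sub>R axis q 1) has_derivative (\<lambda>h. h *\<^sub>R axis q 1)) (at t)"
    by (auto intro!: derivative_eq_intros)
  from has_derivative_compose[OF this] assms
  have "((\<lambda>t. f (x + t *\<^sub>R axis q 1) \<xi>) has_derivative
      (\<lambda>h. \<Sum>p\<in>UNIV. ((h *\<^sub>R axis q 1) $ p) *\<^sub>R f' p (x + t *\<^sub>R axis q 1) \<xi>)) (at t)"
    unfolding position_gradient_def by blast
  then show ?thesis
    by (simp add: has_vector_derivative_def axis_def if_distrib[of "\<lambda>c. c *\<^sub>R _"] if_distrib[of "(*) _"]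
        sum.delta cong: if_cong)
qed

lemma continuous_on_monomial:
  "continuous_on A (\<lambda>\<xi>::real^3. complex_of_real (\<Prod>i\<leftarrow>idx. \<xi> $ i))"
  by (induction idx) (auto intro!: continuous_intros)

lemma moment_integrand_continuous:
  assumes "source r f"
  shows "continuous_on unit_sphere (\<lambda>\<xi>. ray_transform \<alpha> f k x \<xi> * of_real (\<Prod>i\<leftarrow>idx. \<xi> $ i))"
  by (intro continuous_on_mult continuous_on_monomial ray_transform_continuous_compose[OF assms]
      continuous_on_const continuous_on_id) auto

text \<open>Multi-indices of length other than \<open>p\<close> are covered too, both sides being zero; this lets the later
identities hold between tensor fields and not only between their components of the right rank.\<close>

lemma angular_moment_derivative:
  assumes grad: "position_gradient r f f'"
  shows "((\<lambda>t. angular_moment \<alpha> f k p (x + t *\<^sub>R axis q 1) idx) has_vector_derivative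
           angular_moment \<alpha> (f' q) k p (x + t *\<^sub>R axis q 1) idx) (at t)"
proof (cases "length idx = p")
  case True
  have src: "source r f" "source r (f' q)"
    using grad by (auto simp: position_gradient_def)
  have "continuous_on (UNIV \<times> unit_sphere)
      (\<lambda>z. ray_transform \<alpha> (f' q) k (x + fst z *\<^sub>R axis q 1) (snd z) *
        complex_of_real (\<Prod>i\<leftarrow>idx. snd z $ i))"
    by (intro continuous_on_mult continuous_on_compose2[OF continuous_on_monomial[of UNIV]]
        ray_transform_continuous_compose[OF src(2)] continuous_intros) auto
  then show ?thesis
    unfolding angular_moment_def if_P[OF True]
    by (intro sphere_integral_derivative moment_integrand_continuous[OF src(1)]
        has_vector_derivative_mult_left ray_transform_derivative[OF src]
        position_gradient_along_axis[OF grad]) (simp_all add: split_beta)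
qed (simp add: angular_moment_def)

lemma has_partial_angular_moment:
  assumes "position_gradient r f f'"
  shows "has_partial q (\<lambda>y. angular_moment \<alpha> f k p y idx) x"
  unfolding has_partial_def using angular_moment_derivative[OF assms] by (rule differentiableI_vector)

lemma partial_angular_moment:
  assumes "position_gradient r f f'"
  shows "partial q (\<lambda>y. angular_moment \<alpha> f k p y idx) x = angular_moment \<alpha> (f' q) k p x idx"
  using vector_derivative_at[OF angular_moment_derivative[OF assms, of \<alpha> k p x q idx 0]]
  by (simp add: partial_def)

text \<open>The last index \<open>q\<close> of the moment contributes a factor \<open>\<xi>\<^sup>q\<close>, and summing \<open>\<xi>\<^sup>q \<partial>u/\<partial>x\<^sup>q\<close> over \<open>q\<close> under
the integral produces the left side of the transport equation.\<close>

lemma divergence_angular_moment: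
  assumes grad: "position_gradient r f f'"
  shows "divergence (angular_moment \<alpha> f (Suc k) (Suc p)) x idx =
    of_nat (Suc k) * angular_moment \<alpha> f k p x idx - \<alpha> * angular_moment \<alpha> f (Suc k) p x idx"
proof (cases "length idx = p")
  case True
  have src: "source r f" "\<And>q. source r (f' q)"
    and deriv: "\<And>\<xi> x. \<xi> \<in> unit_sphere \<Longrightarrow>
      ((\<lambda>y. f y \<xi>) has_derivative (\<lambda>h. \<Sum>q\<in>UNIV. (h $ q) *\<^sub>R f' q x \<xi>)) (at x)"
    using grad by (auto simp: position_gradient_def)
  let ?m = "\<lambda>\<xi>::real^3. complex_of_real (\<Prod>i\<leftarrow>idx. \<xi> $ i)"
  have int: "integrable sphere_measure (\<lambda>\<xi>. ray_transform \<alpha> h j x \<xi> * of_real (\<Prod>i\<leftarrow>is. \<xi> $ i))"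
    if "source r h" for h j "is"
    by (intro integrable_sphere_measure moment_integrand_continuous[OF that])
  have "divergence (angular_moment \<alpha> f (Suc k) (Suc p)) x idx =
      (\<Sum>q\<in>UNIV. angular_moment \<alpha> (f' q) (Suc k) (Suc p) x (idx @ [q]))"
    by (simp only: divergence_def partial_angular_moment[OF grad])
  also have "\<dots> = (\<Sum>q\<in>UNIV. \<integral>\<xi>. ray_transform \<alpha> (f' q) (Suc k) x \<xi> *
         of_real (\<Prod>i\<leftarrow>idx @ [q]. \<xi> $ i) \<partial>sphere_measure)"
    using True by (simp add: angular_moment_def)
  also have "\<dots> = (\<integral>\<xi>. (\<Sum>q\<in>UNIV. ray_transform \<alpha> (f' q) (Suc k) x \<xi> *
         of_real (\<Prod>i\<leftarrow>idx @ [q]. \<xi> $ i)) \<partial>sphere_measure)"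
    by (intro Bochner_Integration.integral_sum[symmetric] int src)
  also have "\<dots> = (\<integral>\<xi>. of_nat (Suc k) * (ray_transform \<alpha> f k x \<xi> * ?m \<xi>) -
         \<alpha> * (ray_transform \<alpha> f (Suc k) x \<xi> * ?m \<xi>) \<partial>sphere_measure)"
  proof (rule Bochner_Integration.integral_cong[OF refl])
    fix \<xi> assume "\<xi> \<in> space sphere_measure"
    then have \<xi>: "\<xi> \<in> unit_sphere"
      by (simp add: sphere_measure_def space_restrict_space)
    have "(\<Sum>q\<in>UNIV. ray_transform \<alpha> (f' q) (Suc k) x \<xi> * of_real (\<Prod>i\<leftarrow>idx @ [q]. \<xi> $ i)) =
        (\<Sum>q\<in>UNIV. of_real (\<xi> $ q) * ray_transform \<alpha> (f' q) (Suc k) x \<xi>) * ?m \<xi>"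
      unfolding sum_distrib_right by (intro sum.cong) (simp_all add: mult_ac)
    also have "\<dots> = (of_nat (Suc k) * ray_transform \<alpha> f k x \<xi> -
        \<alpha> * ray_transform \<alpha> f (Suc k) x \<xi>) * ?m \<xi>"
      by (subst transport_equation[OF src \<xi> deriv[OF \<xi>]]) simp
    finally show "(\<Sum>q\<in>UNIV. ray_transform \<alpha> (f' q) (Suc k) x \<xi> * of_real (\<Prod>i\<leftarrow>idx @ [q]. \<xi> $ i)) =
        of_nat (Suc k) * (ray_transform \<alpha> f k x \<xi> * ?m \<xi>) -
        \<alpha> * (ray_transform \<alpha> f (Suc k) x \<xi> * ?m \<xi>)"
      by (simp only: left_diff_distrib mult.assoc)
  qed
  also have "\<dots> = of_nat (Suc k) * angular_moment \<alpha> f k p x idx -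
      \<alpha> * angular_moment \<alpha> f (Suc k) p x idx"
    unfolding angular_moment_def if_P[OF True]
    by (subst Bochner_Integration.integral_diff)
       (intro integrable_mult_right int src, intro integrable_mult_right int src, simp)
  finally show ?thesis .
next
  case False
  then show ?thesis
    unfolding divergence_def partial_angular_moment[OF grad] by (simp add: angular_moment_def)
qed

lemma has_partial_sum:
  assumes "finite J" "\<And>j. j \<in> J \<Longrightarrow> has_partial q (g j) x"
  shows "has_partial q (\<lambda>y. \<Sum>j\<in>J. c j * g j y) x"
  using assms unfolding has_partial_def
  by (intro differentiable_sum differentiable_mult differentiable_const) auto

lemma partial_sum:
  assumes "finite J" "\<And>j. j \<in> J \<Longrightarrow> has_partial q (g j) x"
  shows "partial q (\<lambda>y. \<Sum>j\<in>J. c j * g j y) x = (\<Sum>j\<in>J. c j * partial q (g j) x)"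
  unfolding partial_def
  by (intro vector_derivative_at has_vector_derivative_sum has_vector_derivative_mult_right)
     (use assms in \<open>auto simp: has_partial_def vector_derivative_works\<close>)

lemma divergence_sum:
  assumes "finite J" "\<And>j q js. j \<in> J \<Longrightarrow> has_partial q (\<lambda>y. w j y js) x"
  shows "divergence (\<lambda>y js. \<Sum>j\<in>J. c j * w j y js) x idx = (\<Sum>j\<in>J. c j * divergence (w j) x idx)"
  unfolding divergence_def using assms
  by (simp only: partial_sum sum_distrib_left) (rule sum.swap)

text \<open>Pascal's rule in summed form: the operator (identity + shift), iterated \<open>m + 1\<close> times on \<open>b\<close>
and read off at \<open>0\<close>.\<close>

lemma sum_binomial_Suc:
  fixes b :: "nat \<Rightarrow> 'a::comm_semiring_1"
  shows "(\<Sum>j\<le>m. of_nat (m choose j) * (b j + b (Suc j))) =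
         (\<Sum>j\<le>Suc m. of_nat (Suc m choose j) * b j)"
proof -
  have "(\<Sum>j\<le>m. of_nat (m choose j) * b j) = (\<Sum>j\<le>Suc m. of_nat (m choose j) * b j)"
    by (simp add: binomial_eq_0)
  also have "\<dots> = b 0 + (\<Sum>j\<le>m. of_nat (m choose Suc j) * b (Suc j))"
    by (subst sum.atMost_Suc_shift) simp
  finally show ?thesis
    unfolding sum.atMost_Suc_shift
    by (simp add: algebra_simps sum.distrib)
qed

text \<open>The iterate on rank \<open>p + m + 1\<close> is one divergence of the iterate on rank \<open>(p + 1) + m\<close>, so
the induction generalises over \<open>k\<close> and \<open>p\<close> and uses its hypothesis at \<open>k + 1\<close> and \<open>p + 1\<close>.\<close>

lemma divergence_funpow_angular_moment:
  assumes grad: "position_gradient r f f'"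
  shows "(divergence ^^ m) (angular_moment \<alpha> f (k + m) (p + m)) =
    (\<lambda>x idx. \<Sum>j\<le>m. (-1) ^ j * of_nat (m choose j) * \<alpha> ^ j * (fact (k + m) / fact (k + j)) *
       angular_moment \<alpha> f (k + j) p x idx)"
proof (induction m arbitrary: k p)
  case 0
  show ?case by simp
next
  case (Suc m)
  let ?c = "\<lambda>j. (-1) ^ j * of_nat (m choose j) * \<alpha> ^ j * (fact (Suc k + m) / fact (Suc k + j))"
  show ?case
  proof (intro ext)
    fix x idx
    \<comment> \<open>Normalised by \<open>(k + j)!\<close> and with the sign absorbed, the one-step identity has no coefficients:\<close>
    \<comment> \<open>each divergence turns into \<open>b j + b (Suc j)\<close>.\<close>
    define b where "b j = (- \<alpha>) ^ j * angular_moment \<alpha> f (k + j) p x idx / fact (k + j)" for j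
    have step: "?c j * divergence (angular_moment \<alpha> f (Suc k + j) (Suc p)) x idx =
        fact (k + Suc m) * (of_nat (m choose j) * (b j + b (Suc j)))" for j
    proof -
      have "fact (Suc k + j) = of_nat (Suc (k + j)) * (fact (k + j) :: complex)"
        by simp
      moreover have "of_nat (Suc (k + j)) \<noteq> (0 :: complex)"
        by (simp only: of_nat_eq_0_iff)
      ultimately show ?thesis
        unfolding b_def add_Suc divergence_angular_moment[OF grad]
        by (simp add: field_simps power_minus[of \<alpha>] del: of_nat_Suc)
    qed
    have "(divergence ^^ Suc m) (angular_moment \<alpha> f (k + Suc m) (p + Suc m)) x idx =
        divergence ((divergence ^^ m) (angular_moment \<alpha> f (Suc k + m) (Suc p + m))) x idx"
      by simp
    also have "\<dots> = (\<Sum>j\<le>m. ?c j * divergence (angular_moment \<alpha> f (Suc k + j) (Suc p)) x idx)"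
      unfolding Suc.IH by (rule divergence_sum) (auto intro: has_partial_angular_moment[OF grad])
    also have "\<dots> = fact (k + Suc m) * (\<Sum>j\<le>m. of_nat (m choose j) * (b j + b (Suc j)))"
      unfolding step sum_distrib_left ..
    also have "\<dots> = fact (k + Suc m) * (\<Sum>j\<le>Suc m. of_nat (Suc m choose j) * b j)"
      unfolding sum_binomial_Suc ..
    also have "\<dots> = (\<Sum>j\<le>Suc m. (-1) ^ j * of_nat (Suc m choose j) * \<alpha> ^ j *
        (fact (k + Suc m) / fact (k + j)) * angular_moment \<alpha> f (k + j) p x idx)"
      unfolding sum_distrib_left
      by (intro sum.cong refl) (simp add: b_def power_minus[of \<alpha>] mult_ac)
    finally show "(divergence ^^ Suc m) (angular_moment \<alpha> f (k + Suc m) (p + Suc m)) x idx =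
       (\<Sum>j\<le>Suc m. (-1) ^ j * of_nat (Suc m choose j) * \<alpha> ^ j *
        (fact (k + Suc m) / fact (k + j)) * angular_moment \<alpha> f (k + j) p x idx)" .
  qed
qed

theorem theorem4p1:
  fixes D :: "(real^3) set"
    and f :: "real^3 \<Rightarrow> real^3 \<Rightarrow> complex"
    and k n p :: nat
    and \<epsilon> \<kappa> :: real
    and \<alpha> :: complex
  assumes "open D" and "connected D" and "D \<noteq> {}" and "bounded D" and "convex D"
    and "smooth_boundary D"
    and "Ck_on 1 (\<lambda>(x, \<xi>). f x \<xi>) (D \<times> unit_sphere)"
    and "bounded ((\<lambda>(x, \<xi>). f x \<xi>) ` (D \<times> unit_sphere))"
    and "\<exists>K. compact K \<and> K \<subseteq> D \<and> (\<forall>x \<xi>. x \<notin> K \<longrightarrow> \<xi> \<in> unit_sphere \<longrightarrow> f x \<xi> = 0)"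
    and "n \<ge> 1"
    and "\<epsilon> \<ge> 0"
    and "\<alpha> = of_real \<epsilon> + \<i> * of_real \<kappa>"
  shows "(\<forall>m<n. divergence_exists (p + n - m - 1)
            ((divergence ^^ m) (angular_moment \<alpha> f (k + n) (p + n)))) \<and>
         (\<forall>x idx. length idx = p \<longrightarrow>
            (divergence ^^ n) (angular_moment \<alpha> f (k + n) (p + n)) x idx =
            (\<Sum>j=0..n. (-1) ^ j * of_nat (n choose j) * \<alpha> ^ j * (fact (k + n) / fact (k + j)) *
               angular_moment \<alpha> f (k + j) p x idx))"
proof -
  obtain K where "compact K" "K \<subseteq> D" "\<And>x \<xi>. x \<notin> K \<Longrightarrow> \<xi> \<in> unit_sphere \<Longrightarrow> f x \<xi> = 0"
    using assms(9) by blast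
  then obtain r f' where grad: "position_gradient r f f'"
    using position_gradient_exists[OF assms(1,7)] by blast
  \<comment> \<open>Raising \<open>k\<close> and \<open>p\<close> by \<open>n - m\<close> turns the \<open>m\<close>-th iterate into one of complete order.\<close>
  have "has_partial q (\<lambda>y. (divergence ^^ m) (angular_moment \<alpha> f (k + n) (p + n)) y js) x"
    if "m < n" for m q js x
  proof -
    have "k + n = (k + n - m) + m" "p + n = (p + n - m) + m"
      using that by auto
    then have "(divergence ^^ m) (angular_moment \<alpha> f (k + n) (p + n)) =
        (divergence ^^ m) (angular_moment \<alpha> f ((k + n - m) + m) ((p + n - m) + m))"
      by simp
    then show ?thesis
      unfolding divergence_funpow_angular_moment[OF grad]
      by (simp only:) (intro has_partial_sum has_partial_angular_moment[OF grad] finite_atMost)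
  qed
  then show ?thesis
    by (simp add: divergence_exists_def divergence_funpow_angular_moment[OF grad] atMost_atLeast0)
qed

end
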